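(* Fix a real number $M > 0$, and call a fiber small if it is nonempty and has diameter less than $M$. (i) Let $n > 1$ be an integer and let $f : \mathbb{R}^n \rightarrow \mathbb{R}$ be a continuous map. Then the union of all small fibers of $f$ is a bounded subset of $\mathbb{R}^n$. (ii) For all integers $n > m > 1$, there exists a continuous map $f : \mathbb{R}^n \rightarrow \mathbb{R}^m$ such that the union of all small fibers of $f$ is an unbounded subset of $\mathbb{R}^n$.
   Context: The fibers of a map $f : X \to Y$ are the preimages $f^{-1}(y) = \{x \in X : f(x) = y\}$ of points $y \in Y$. The diameter of a set $A \subseteq \mathbb{R}^n$ is the supremum $\sup\{d(x,y) : x, y \in A\}$ (possibly $+\infty$), where $d(x,y)$ denotes the Euclidean distance between $x$ and $y$. The number $M > 0$ is arbitrary but fixed. *)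

theory Defs
  imports "HOL-Analysis.Analysis" "HOL-Library.Extended_Real"
begin

text \<open>The library constant \<open>diameter\<close> is real-valued, and its value on an unbounded set carries no
  information. The diameter used here is the supremum in the extended reals, so it is infinite
  exactly on unbounded sets.\<close>

definition ediameter :: "'a::metric_space set \<Rightarrow> ereal" where
  "ediameter A = (SUP (x, y) \<in> A \<times> A. ereal (dist x y))"

definition fibers :: "('a \<Rightarrow> 'b) \<Rightarrow> 'a set set" where
  "fibers f = {f -` {y} | y. True}"

definition small_fibers :: "real \<Rightarrow> ('a::metric_space \<Rightarrow> 'b) \<Rightarrow> 'a set set" where
  "small_fibers M f = {F \<in> fibers f. F \<noteq> {} \<and> ediameter F < ereal M}"

lemma ediameter_bounded:
  assumes "bounded A" "A \<noteq> {}"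
  shows "ediameter A = ereal (diameter A)"
proof (rule antisym)
  show "ediameter A \<le> ereal (diameter A)"
    unfolding ediameter_def using diameter_bounded_bound[OF assms(1)] by (auto intro!: SUP_least)
next
  obtain a where a: "a \<in> A" using assms(2) by blast
  have le: "ereal (dist x y) \<le> ediameter A" if "x \<in> A" "y \<in> A" for x y
    unfolding ediameter_def using that by (intro SUP_upper2[of "(x, y)"]) auto
  show "ereal (diameter A) \<le> ediameter A"
  proof (cases "ediameter A")
    case (real r)
    have "diameter A \<le> r"
      unfolding diameter_def using le assms(2) real by (auto intro!: cSUP_least)
    then show ?thesis using real by simp
  next
    case MInf
    then show ?thesis using le[OF a a] by simp
  qed simp
qed

lemma ediameter_unbounded:
  assumes "\<not> bounded A"
  shows "ediameter A = \<infinity>"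
proof -
  have ne: "A \<noteq> {}" using assms by auto
  then obtain a where a: "a \<in> A" by blast
  have le: "ereal (dist a y) \<le> ediameter A" if "y \<in> A" for y
    unfolding ediameter_def using that a by (intro SUP_upper2[of "(a, y)"]) auto
  show ?thesis
  proof (cases "ediameter A")
    case (real r)
    then have "\<forall>y\<in>A. dist a y \<le> r" using le by auto
    then show ?thesis using assms unfolding bounded_def by blast
  next
    case MInf
    then show ?thesis using le[OF a] by simp
  qed
qed

end

theory Submission
  imports Defs
begin

text \<open>For (i), take three points of small fibers at pairwise distance at least \<open>M\<close>. Their values are
  distinct, and the complement of the ball of radius \<open>M\<close> around the point with the middle value is
  connected, so the middle value is also attained outside that ball, a contradiction. For (ii), the
  map \<open>x \<mapsto> (x\<^sub>1, \<bar>(x\<^sub>2, \<dots>, x\<^sub>n)\<bar>)\<close> into a plane has a single point as its fiber over each \<open>(t, 0)\<close>.\<close>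

lemma dist_less_of_ediameter_less:
  assumes "ediameter A < ereal M" "x \<in> A" "y \<in> A"
  shows "dist x y < M"
proof -
  have "ereal (dist x y) \<le> ediameter A"
    unfolding ediameter_def using assms(2,3) by (intro SUP_upper2[of "(x, y)"]) auto
  then show ?thesis
    using assms(1) by (metis le_less_trans ereal_less_eq(3) less_ereal.simps(1))
qed

text \<open>Each point lies on exactly one fiber, the one over its own value, so both parts can be
  argued point by point.\<close>

lemma Union_small_fibers_iff:
  "x \<in> \<Union>(small_fibers M f) \<longleftrightarrow> ediameter (f -` {f x}) < ereal M"
  unfolding small_fibers_def fibers_def by auto

text \<open>The points are picked greedily: the balls of radius \<open>M\<close> around those
  already chosen have bounded union, so \<open>S\<close> contains a point outside them.\<close>

lemma unbounded_three_separated_points: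
  fixes S :: "'a::metric_space set"
  assumes "\<not> bounded S"
  obtains x y z where "x \<in> S" "y \<in> S" "z \<in> S" "dist x y \<ge> M" "dist y z \<ge> M" "dist x z \<ge> M"
proof -
  have far: "\<exists>x\<in>S. x \<notin> T" if "bounded T" for T
    using assms that by (meson bounded_subset subsetI)
  obtain x where x: "x \<in> S" using far[of "{}"] by auto
  obtain y where y: "y \<in> S" "y \<notin> ball x M" using far[of "ball x M"] by auto
  obtain z where z: "z \<in> S" "z \<notin> ball x M \<union> ball y M" using far[of "ball x M \<union> ball y M"] by auto
  show thesis using that[of x y z] x y z by auto
qed

lemma small_fiber_not_between:
  fixes f :: "'a::euclidean_space \<Rightarrow> real"
  assumes "DIM('a) \<ge> 2" "continuous_on UNIV f" "y \<in> \<Union>(small_fibers M f)"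
    and "dist y x \<ge> M" "dist y z \<ge> M"
  shows "\<not> (f x < f y \<and> f y < f z)"
proof
  assume less: "f x < f y \<and> f y < f z"
  \<comment> \<open>The dimension enters here: removing a bounded convex set from a line could
    disconnect it.\<close>
  have "connected (- ball y M)"
    using assms(1) by (intro connected_complement_bounded_convex) auto
  then have "connected (f ` (- ball y M))"
    using assms(2) by (meson connected_continuous_image continuous_on_subset subset_UNIV)
  \<comment> \<open>Both \<open>x\<close> and \<open>z\<close> lie outside the ball, so the
    connected image has values on either side of \<open>f y\<close>.\<close>
  then have "f y \<in> f ` (- ball y M)"
    using connectedD_interval[of _ "f x" "f z" "f y"] less assms(4,5) by auto
  then obtain w where "f w = f y" "dist y w \<ge> M" by auto
  then show False
    using dist_less_of_ediameter_less[of "f -` {f y}" M y w] assms(3)[unfolded Union_small_fibers_iff]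
    by auto
qed

lemma bounded_Union_small_fibers:
  fixes f :: "'a::euclidean_space \<Rightarrow> real"
  assumes "DIM('a) \<ge> 2" "continuous_on UNIV f"
  shows "bounded (\<Union>(small_fibers M f))"
proof (rule ccontr)
  let ?S = "\<Union>(small_fibers M f)"
  assume "\<not> bounded ?S"
  then obtain x y z where S: "x \<in> ?S" "y \<in> ?S" "z \<in> ?S"
    and d: "dist x y \<ge> M" "dist y z \<ge> M" "dist x z \<ge> M"
    by (rule unbounded_three_separated_points)
  \<comment> \<open>Points with equal values share a fiber; if it is small, they are closer than
    \<open>M\<close>.\<close>
  have distinct: "f u \<noteq> f v" if "u \<in> ?S" "dist u v \<ge> M" for u v
    using dist_less_of_ediameter_less[of "f -` {f u}" M u v] that[unfolded Union_small_fibers_iff]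
    by auto
  have "f x \<noteq> f y" "f y \<noteq> f z" "f x \<noteq> f z"
    using distinct S d by blast+
  moreover note between = small_fiber_not_between[OF assms]
  \<comment> \<open>These are all six strict orderings of three distinct values; in each, the middle
    value belongs to one of the three points.\<close>
  have "\<not> (f x < f y \<and> f y < f z)" "\<not> (f z < f y \<and> f y < f x)"
    "\<not> (f y < f x \<and> f x < f z)" "\<not> (f z < f x \<and> f x < f y)"
    "\<not> (f x < f z \<and> f z < f y)" "\<not> (f y < f z \<and> f z < f x)"
    using between[of y M x z] between[of y M z x] between[of x M y z] between[of x M z y]
      between[of z M x y] between[of z M y x] S d by (simp_all only: dist_commute simp_thms)
  ultimately show False by linarith
qed

text \<open>As a scalar multiple of a fixed vector, \<open>axis k t\<close> is open to the rules for
  continuity and norms.\<close>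

lemma axis_eq_scaleR: "axis k t = t *\<^sub>R axis k (1::real)"
  by (auto simp: axis_def vec_eq_iff)

lemma unbounded_of_axis:
  fixes S :: "(real ^ 'n::finite) set"
  assumes "\<And>t. axis i t \<in> S"
  shows "\<not> bounded S"
proof
  assume "bounded S"
  then obtain B where "\<And>x. x \<in> S \<Longrightarrow> norm x \<le> B" by (auto simp: bounded_iff)
  from this[OF assms[of "\<bar>B\<bar> + 1"]] show False
    by (simp add: axis_eq_scaleR[of i "\<bar>B\<bar> + 1"])
qed

lemma exists_unbounded_Union_small_fibers:
  assumes "M > 0" "CARD('m::finite) > 1"
  shows "\<exists>f :: real ^ 'n::finite \<Rightarrow> real ^ 'm. continuous_on UNIV f \<and> \<not> bounded (\<Union>(small_fibers M f))"
proof -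
  obtain a b :: 'm where ab: "a \<noteq> b"
    using assms(2) card_le_Suc0_iff_eq[of "UNIV :: 'm set"] by fastforce
  fix i :: 'n
  define f :: "real ^ 'n \<Rightarrow> real ^ 'm"
    where "f x = axis a (x $ i) + axis b (norm (x - axis i (x $ i)))" for x
  have "continuous_on UNIV f"
    unfolding f_def axis_eq_scaleR[of _ "_ $ _"] axis_eq_scaleR[of _ "norm _"]
    by (intro continuous_intros)
  moreover have "axis i t \<in> \<Union>(small_fibers M f)" for t
  proof -
    have "x = axis i t" if "f x = f (axis i t)" for x
    proof -
      \<comment> \<open>Coordinate \<open>b\<close> of \<open>f (axis i t)\<close> is 0, which
        forces \<open>x = axis i (x $ i)\<close>; coordinate \<open>a\<close> then gives
        \<open>x $ i = t\<close>.\<close>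
      have "f x $ a = f (axis i t) $ a" "f x $ b = f (axis i t) $ b" using that by auto
      then show ?thesis using ab by (simp add: f_def axis_def)
    qed
    then have "f -` {f (axis i t)} = {axis i t}" by auto
    \<comment> \<open>A singleton has diameter 0, which is below \<open>M\<close>.\<close>
    then show ?thesis
      using assms(1) unfolding Union_small_fibers_iff by (simp add: ediameter_bounded)
  qed
  then have "\<not> bounded (\<Union>(small_fibers M f))"
    by (intro unbounded_of_axis[of i]) blast
  ultimately show ?thesis by blast
qed

theorem theorem2:
  fixes M :: real
  assumes "M > 0"
  shows "(CARD('n::finite) > 1 \<longrightarrow>
           (\<forall>f :: real ^ 'n \<Rightarrow> real. continuous_on UNIV f \<longrightarrow> bounded (\<Union>(small_fibers M f)))) \<and>
         (CARD('n) > CARD('m::finite) \<and> CARD('m) > 1 \<longrightarrow>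
           (\<exists>f :: real ^ 'n \<Rightarrow> real ^ 'm. continuous_on UNIV f \<and> \<not> bounded (\<Union>(small_fibers M f))))"
  using assms
  by (auto intro!: bounded_Union_small_fibers exists_unbounded_Union_small_fibers)

end
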